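(* For every integer $n\geq 2$, $$K_n\leq \frac{R_n}{n+1},$$ and in particular $$\log_2 K_n\leq n^2-1-\log_2(n+1).$$
   Context: Write $[n+1]=\{1,\dots,n+1\}$, let $e_1,\dots,e_{n+1}$ be the standard basis of $\mathbb{R}^{n+1}$, and $V_\emptyset=\{\mathbf{x}\in\mathbb{R}^{n+1}:\sum_i x_i=0\}$. Resonance arrangement: $\mathcal{R}_n$ is the arrangement in $V_\emptyset$ of the hyperplanes $\{\mathbf{x}\in V_\emptyset:\sum_{i\in S}x_i=0\}$ for $\emptyset\neq S\subsetneq[n+1]$. $R_n$ is the number of its chambers (connected components of the complement in $V_\emptyset$ of the union of the hyperplanes). A positive alternating tree on $[n+1]$ is a directed graph on vertex set $[n+1]$ whose underlying undirected graph is a tree, all of whose arcs $(i,j)$ satisfy $i<j$, and in which each vertex is either a source (all incident arcs outgoing) or a sink (all incident arcs incoming). Its root cone is $\mathcal{C}(T)=\{\sum_{(i,j)\in E(T)}f(i,j)(e_i-e_j): f(i,j)\geq0\}\subset V_\emptyset$. Kostant chambers: given a collection of cones whose intersection is full-dimensional in $V_\emptyset$, the interior (in $V_\emptyset$) of the intersection is called a refined chamber; a maximally refined chamber is a refined chamber that does not contain any other refined chamber. The Kostant chambers are the maximally refined chambers obtained from intersections of root cones $\mathcal{C}(T)$ of positive alternating trees $T$ on $[n+1]$. (Equivalently, they are the full-dimensional cones in the common refinement of all triangulations of the positive root cone of type $A_n$; they are the domains of polynomiality of the Kostant partition function of type $A_n$.) $K_n$ is the number of Kostant chambers. *)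

theory Defs
  imports "HOL-Analysis.Analysis" "HOL-Library.Function_Algebras"
begin

text \<open>
  The dimension is a genuine natural number here, so \<open>\<real>\<^sup>n\<^sup>+\<^sup>1\<close> is modelled by the functions
  \<^typ>\<open>nat \<Rightarrow> real\<close> that vanish outside the index set \<open>{1..n + 1}\<close>.  Linear notions come from the
  pointwise vector space structure.  The library topology on functions is the product topology,
  which induces the Euclidean topology on this finite-dimensional subspace.
\<close>

instantiation "fun" :: (type, real_vector) real_vector
begin

definition scaleR_fun :: "real \<Rightarrow> ('a \<Rightarrow> 'b) \<Rightarrow> 'a \<Rightarrow> 'b" where
  "scaleR_fun c x = (\<lambda>i. c *\<^sub>R x i)"

instance
  by standard (auto simp: scaleR_fun_def plus_fun_def scaleR_add_right scaleR_add_left)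

end

definition basis_vec :: "nat \<Rightarrow> nat \<Rightarrow> real" where
  "basis_vec i = (\<lambda>k. if k = i then 1 else 0)"

definition V_empty :: "nat \<Rightarrow> (nat \<Rightarrow> real) set" where
  "V_empty n = {x. (\<forall>i. i \<notin> {1..n + 1} \<longrightarrow> x i = 0) \<and> (\<Sum>i\<in>{1..n + 1}. x i) = 0}"


section \<open>The resonance arrangement\<close>

definition resonance_hyperplane :: "nat \<Rightarrow> nat set \<Rightarrow> (nat \<Rightarrow> real) set" where
  "resonance_hyperplane n S = {x \<in> V_empty n. (\<Sum>i\<in>S. x i) = 0}"

definition resonance_arrangement :: "nat \<Rightarrow> (nat \<Rightarrow> real) set set" where
  "resonance_arrangement n = {resonance_hyperplane n S |S. S \<noteq> {} \<and> S \<subset> {1..n + 1}}"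

definition resonance_chambers :: "nat \<Rightarrow> (nat \<Rightarrow> real) set set" where
  "resonance_chambers n = components (V_empty n - \<Union> (resonance_arrangement n))"

definition resonance_number :: "nat \<Rightarrow> nat" where
  "resonance_number n = card (resonance_chambers n)"


section \<open>Positive alternating trees\<close>

text \<open>
  A directed graph on a fixed vertex set is given by its set \<open>E\<close> of arcs \<open>(i, j)\<close>.  The underlying
  undirected graph has the adjacency relation \<^term>\<open>E \<union> E\<inverse>\<close>; this forgets nothing but the
  orientation for the graphs below, which have no loops and no pairs of opposite arcs.  An
  undirected cycle is a closed sequence of at least three distinct vertices.
\<close>

definition undirected_connected :: "'a set \<Rightarrow> 'a rel \<Rightarrow> bool" where
  "undirected_connected X E \<longleftrightarrow> X \<noteq> {} \<and> (\<forall>u\<in>X. \<forall>v\<in>X. (u, v) \<in> (E \<union> E\<inverse>)\<^sup>*)"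

definition undirected_cycle :: "'a rel \<Rightarrow> 'a list \<Rightarrow> bool" where
  "undirected_cycle E p \<longleftrightarrow> length p \<ge> 3 \<and> distinct p \<and>
     (\<forall>k<length p. (p ! k, p ! (Suc k mod length p)) \<in> E \<union> E\<inverse>)"

definition underlying_tree :: "'a set \<Rightarrow> 'a rel \<Rightarrow> bool" where
  "underlying_tree X E \<longleftrightarrow> undirected_connected X E \<and> (\<nexists>p. undirected_cycle E p)"

definition is_source :: "'a rel \<Rightarrow> 'a \<Rightarrow> bool" where
  "is_source E v \<longleftrightarrow> (\<forall>u. (u, v) \<notin> E)"

definition is_sink :: "'a rel \<Rightarrow> 'a \<Rightarrow> bool" where
  "is_sink E v \<longleftrightarrow> (\<forall>w. (v, w) \<notin> E)"

definition positive_alternating_tree :: "nat \<Rightarrow> nat rel \<Rightarrow> bool" where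
  "positive_alternating_tree n E \<longleftrightarrow>
     E \<subseteq> {1..n + 1} \<times> {1..n + 1} \<and>
     underlying_tree {1..n + 1} E \<and>
     (\<forall>(i, j)\<in>E. i < j) \<and>
     (\<forall>v\<in>{1..n + 1}. is_source E v \<or> is_sink E v)"

definition root_cone :: "nat rel \<Rightarrow> (nat \<Rightarrow> real) set" where
  "root_cone E = {\<Sum>(i, j)\<in>E. f (i, j) *\<^sub>R (basis_vec i - basis_vec j) |f. \<forall>a\<in>E. 0 \<le> f a}"


section \<open>Kostant chambers\<close>

text \<open>
  A cone contains the origin, so it is full-dimensional in \<open>V\<close> iff its linear dimension is that
  of \<open>V\<close>.  Collections of cones are required to be nonempty, since the empty intersection would be
  the whole function space.
\<close>

definition refined_chambers ::
    "(nat \<Rightarrow> real) set \<Rightarrow> (nat \<Rightarrow> real) set set \<Rightarrow> (nat \<Rightarrow> real) set set" where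
  "refined_chambers V \<C> =
     {top_of_set V interior_of \<Inter>\<D> |\<D>. \<D> \<noteq> {} \<and> \<D> \<subseteq> \<C> \<and> dim (\<Inter>\<D>) = dim V}"

definition maximally_refined_chambers ::
    "(nat \<Rightarrow> real) set \<Rightarrow> (nat \<Rightarrow> real) set set \<Rightarrow> (nat \<Rightarrow> real) set set" where
  "maximally_refined_chambers V \<C> =
     {M \<in> refined_chambers V \<C>. \<forall>N\<in>refined_chambers V \<C>. N \<subseteq> M \<longrightarrow> N = M}"

definition kostant_chambers :: "nat \<Rightarrow> (nat \<Rightarrow> real) set set" where
  "kostant_chambers n =
     maximally_refined_chambers (V_empty n) {root_cone E |E. positive_alternating_tree n E}"

definition kostant_number :: "nat \<Rightarrow> nat" where
  "kostant_number n = card (kostant_chambers n)"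

end

(*
The facet inequalities of a root cone are coordinate sums over proper subsets, so membership of a
generic point in a root cone depends only on its resonance chamber, and each Kostant chamber contains
a resonance chamber; by maximality different Kostant chambers contain different ones.  These
resonance chambers have positive prefix sums.  Among the n + 1 cyclic shifts of a generic vector of
total sum 0 at most one has all prefix sums positive, hence (n + 1) K_n <= R_n.  Finally the 2^n - 1
hyperplanes in dimension n cut out at most 2 (2^n - 1)^(n - 1) chambers, by deletion and restriction.
*)

theory Submission
  imports Defs
begin

section \<open>Sign patterns of linear functionals\<close>

text \<open>A resonance chamber is replaced throughout by the finite family of index sets whose
  coordinate sum is positive on it, so all counting happens among subsets of a finite set. A Kostant
  chamber is represented by a generic point of the intersection of its cones, not of the interior;
  of the interior only monotonicity enters. This suffices because an intersection of root cones that
  contains one generic point contains its whole sign class, and a sign class spans the space. Prefix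
  sums are positive because arcs point from smaller to larger indices. Two different rotations
  cannot both have positive prefix sums: some prefix of one is a suffix of the other, and
  complementary sums are opposite. The same opposition pairs each index set with its complement and
  leaves 2^n - 1 hyperplanes. The resulting exponent n(n - 1) + 1 is at most n^2 - 1 exactly from n
  = 2 on.\<close>

definition sign_patterns :: "('i \<Rightarrow> 'v \<Rightarrow> real) \<Rightarrow> 'i set \<Rightarrow> 'v set \<Rightarrow> 'i set set" where
  "sign_patterns h I X = (\<lambda>x. {i \<in> I. 0 < h i x}) ` {x \<in> X. \<forall>i\<in>I. h i x \<noteq> 0}"

lemma sign_patterns_subset_Pow: "sign_patterns h I X \<subseteq> Pow I"
  by (auto simp: sign_patterns_def)

lemma finite_sign_patterns: "finite I \<Longrightarrow> finite (sign_patterns h I X)"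
  by (rule finite_subset[OF sign_patterns_subset_Pow]) simp

lemma sign_patternsI:
  "\<lbrakk>x \<in> X; \<And>i. i \<in> I \<Longrightarrow> h i x \<noteq> 0; T = {i \<in> I. 0 < h i x}\<rbrakk> \<Longrightarrow> T \<in> sign_patterns h I X"
  by (auto simp: sign_patterns_def)

text \<open>Deletion and restriction. Forgetting \<open>i\<close> maps the patterns without
  \<open>i\<close> and those with \<open>i\<close> injectively into the patterns of
  \<open>I\<close>; a pattern hit by both kinds is counted twice, and it also occurs on the kernel
  of \<open>h i\<close>.\<close>

lemma card_sign_patterns_insert:
  fixes h :: "'i \<Rightarrow> 'v::real_vector \<Rightarrow> real"
  assumes "finite I" "i \<notin> I" and lin: "\<And>j. j \<in> insert i I \<Longrightarrow> linear (h j)" and "subspace X"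
  shows "card (sign_patterns h (insert i I) X)
         \<le> card (sign_patterns h I X) + card (sign_patterns h I {x \<in> X. h i x = 0})"
proof -
  let ?Q = "sign_patterns h (insert i I) X"
  define Q0 where "Q0 = {T \<in> ?Q. i \<notin> T}"
  define Q1 where "Q1 = {T \<in> ?Q. i \<in> T}"
  have finQ: "finite ?Q"
    using assms(1) by (intro finite_sign_patterns) simp
  then have fin: "finite Q0" "finite Q1" by (auto simp: Q0_def Q1_def)
  have "?Q = Q0 \<union> Q1" by (auto simp: Q0_def Q1_def)
  then have "card ?Q = card Q0 + card Q1"
    using card_Un_disjoint[OF fin] by (auto simp: Q0_def Q1_def)
  also have "card Q1 = card ((\<lambda>T. T - {i}) ` Q1)"
    unfolding Q1_def by (intro card_image[symmetric] inj_onI) (metis (lifting) insert_Diff mem_Collect_eq)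
  also have "card Q0 + \<dots> = card (Q0 \<union> (\<lambda>T. T - {i}) ` Q1) + card (Q0 \<inter> (\<lambda>T. T - {i}) ` Q1)"
    using fin by (intro card_Un_Int) auto
  also have "\<dots> \<le> card (sign_patterns h I X) + card (sign_patterns h I {x \<in> X. h i x = 0})"
  proof (intro add_mono card_mono)
    show "finite (sign_patterns h I X)" "finite (sign_patterns h I {x \<in> X. h i x = 0})"
      using assms(1) by (rule finite_sign_patterns)+
    show "Q0 \<union> (\<lambda>T. T - {i}) ` Q1 \<subseteq> sign_patterns h I X"
    proof
      fix T assume "T \<in> Q0 \<union> (\<lambda>T. T - {i}) ` Q1"
      then obtain x where x: "x \<in> X" "\<forall>j\<in>insert i I. h j x \<noteq> 0"
        and T: "T = {j \<in> insert i I. 0 < h j x} - {i}"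
        unfolding Q0_def Q1_def sign_patterns_def by blast
      then show "T \<in> sign_patterns h I X"
        using assms(2) by (intro sign_patternsI[of x]) auto
    qed
    show "Q0 \<inter> (\<lambda>T. T - {i}) ` Q1 \<subseteq> sign_patterns h I {x \<in> X. h i x = 0}"
    proof
      fix T assume T: "T \<in> Q0 \<inter> (\<lambda>T. T - {i}) ` Q1"
      then obtain x where x: "x \<in> X" "\<forall>j\<in>insert i I. h j x \<noteq> 0"
        "T = {j \<in> insert i I. 0 < h j x}" "i \<notin> T"
        unfolding Q0_def sign_patterns_def by blast
      from T obtain y where y: "y \<in> X" "\<forall>j\<in>insert i I. h j y \<noteq> 0"
        "T = {j \<in> insert i I. 0 < h j y} - {i}" "0 < h i y"
        unfolding Q1_def sign_patterns_def by blast
      have Tx: "j \<in> T \<longleftrightarrow> 0 < h j x" if "j \<in> insert i I" for j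
        using that by (subst x(3)) blast
      have Ty: "j \<in> T \<longleftrightarrow> 0 < h j y" if "j \<in> I" for j
        using that assms(2) by (subst y(3)) blast
      \<comment> \<open>The segment from \<open>x\<close> to \<open>y\<close> crosses the kernel of
        \<open>h i\<close>; \<open>z\<close> is a positive multiple of the crossing point. Both
        coefficients are positive because \<open>h i x < 0 < h i y\<close>, so every sign shared by
        \<open>x\<close> and \<open>y\<close> survives.\<close>
      define z where "z = h i y *\<^sub>R x - h i x *\<^sub>R y"
      have hz: "h j z = h i y * h j x + (- h i x) * h j y" if "j \<in> insert i I" for j
        using lin[OF that] by (simp add: z_def linear_diff linear_cmul)
      have ix: "h i x < 0" using x(2) x(4) Tx[of i] by simp
      show "T \<in> sign_patterns h I {x \<in> X. h i x = 0}"
      proof (rule sign_patternsI[of z])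
        show "z \<in> {x \<in> X. h i x = 0}"
          using hz[of i] x(1) y(1) \<open>subspace X\<close> by (auto simp: z_def subspace_diff subspace_scale)
        have pos: "0 < h j z" if "j \<in> I" "j \<in> T" for j
        proof -
          have "0 < h j x" "0 < h j y" using that Tx Ty by auto
          then have "0 < h i y * h j x" "h i x * h j y < 0"
            using ix y(4) mult_pos_pos mult_neg_pos by blast+
          then show ?thesis using hz[of j] that(1) by simp
        qed
        have neg: "h j z < 0" if "j \<in> I" "j \<notin> T" for j
        proof -
          have "h j x < 0" "h j y < 0"
            using that bspec[OF x(2), of j] bspec[OF y(2), of j] Tx[of j] Ty[of j] by auto
          then have "h i y * h j x < 0" "0 < h i x * h j y"
            using ix y(4) mult_pos_neg mult_neg_neg by blast+
          then show ?thesis using hz[of j] that(1) by simp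
        qed
        show "h j z \<noteq> 0" if "j \<in> I" for j
          using pos[of j] neg[of j] that by (cases "j \<in> T") simp_all
        show "T = {i \<in> I. 0 < h i z}"
        proof -
          have "T \<subseteq> I" using x(3,4) by blast
          moreover have "j \<in> T \<longleftrightarrow> 0 < h j z" if "j \<in> I" for j
            using pos[of j] neg[of j] that by (cases "j \<in> T") simp_all
          ultimately show ?thesis by blast
        qed
      qed
    qed
  qed
  finally show ?thesis .
qed

text \<open>The projection onto the kernel of \<open>h\<close> along \<open>b\<close> sends
  \<open>b\<close> to 0, so the images of the other generators span the kernel. Dimension is thus
  tracked by the size of a spanning set, which drops by one at each restriction.\<close>

lemma kernel_in_smaller_span:
  fixes h :: "'v::real_vector \<Rightarrow> real"
  assumes "linear h" "finite B" "b \<in> B" "h b \<noteq> 0"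
  obtains B' where "finite B'" "card B' \<le> card B - 1" "{x \<in> span B. h x = 0} = span B'"
proof
  define p where "p v = v - (h v / h b) *\<^sub>R b" for v
  have linp: "linear p"
    unfolding p_def using assms(1)
    by (intro linearI) (auto simp: linear_add linear_cmul algebra_simps add_divide_distrib)
  show "finite (p ` (B - {b}))" using assms(2) by simp
  show "card (p ` (B - {b})) \<le> card B - 1"
    using card_image_le[of "B - {b}" p] assms(2,3) by simp
  have hp: "h (p v) = 0" for v
    using assms by (simp add: p_def linear_diff linear_cmul)
  show "{x \<in> span B. h x = 0} = span (p ` (B - {b}))"
  proof (intro equalityI subsetI)
    fix x assume "x \<in> {x \<in> span B. h x = 0}"
    then have x: "x \<in> span B" "p x = x" by (auto simp: p_def)
    have "p x \<in> span (p ` B)" using x(1) linear_span_image[OF linp, of B] by blast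
    also have "p ` B = insert (p b) (p ` (B - {b}))" using assms(3) by (metis image_insert insert_Diff)
    also have "p b = 0" using assms(4) by (simp add: p_def)
    finally show "x \<in> span (p ` (B - {b}))" using x(2) by simp
  next
    fix x assume "x \<in> span (p ` (B - {b}))"
    moreover have "subspace {x \<in> span B. h x = 0}"
      using assms(1) by (auto simp: subspace_def span_add span_scale span_zero linear_0 linear_add linear_cmul)
    moreover have "p ` (B - {b}) \<subseteq> {x \<in> span B. h x = 0}"
    proof -
      have "p v \<in> span B" if "v \<in> B" for v
        unfolding p_def using that assms(3) by (intro span_diff span_scale span_base)
      then show ?thesis using hp by auto
    qed
    ultimately show "x \<in> {x \<in> span B. h x = 0}" using span_minimal by blast
  qed
qed

text \<open>Induction on the functionals, for all spanning sets at once. With m functionals the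
  recursion yields 2 m^e + 2 m^(e-1), at most 2 (m+1)^e; the factor 2 is the two signs of a single
  functional. A functional that vanishes on the whole span leaves no pattern at all.\<close>

lemma card_sign_patterns_le:
  fixes h :: "'i \<Rightarrow> 'v::real_vector \<Rightarrow> real"
  assumes "finite I" "I \<noteq> {}" "\<And>i. i \<in> I \<Longrightarrow> linear (h i)" "finite B" "card B \<le> Suc e"
  shows "card (sign_patterns h I (span B)) \<le> 2 * card I ^ e"
  using assms
proof (induction I arbitrary: B e rule: finite_ne_induct)
  case (singleton i)
  have "card (sign_patterns h {i} (span B)) \<le> card (Pow {i})"
    using sign_patterns_subset_Pow[of h "{i}" "span B"] by (intro card_mono) auto
  then show ?case by (simp add: card_Pow)
next
  case (insert i I)
  show ?case
  proof (cases "\<exists>b\<in>B. h i b \<noteq> 0")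
    case False
    have "h i x = 0" if "x \<in> span B" for x
      using linear_eq_0_on_span[of "h i" B x] False that insert.prems by auto
    then have "sign_patterns h (insert i I) (span B) = {}" by (auto simp: sign_patterns_def)
    then show ?thesis by simp
  next
    case True
    then obtain b where "b \<in> B" "h i b \<noteq> 0" by blast
    then obtain B' where B': "finite B'" "card B' \<le> card B - 1"
      "{x \<in> span B. h i x = 0} = span B'"
      using kernel_in_smaller_span[of "h i" B b] insert.prems by auto
    have "card (sign_patterns h (insert i I) (span B))
        \<le> card (sign_patterns h I (span B)) + card (sign_patterns h I (span B'))"
      using card_sign_patterns_insert[of I i h "span B"] insert.hyps insert.prems
      unfolding B'(3) by simp
    also have "\<dots> \<le> 2 * card (insert i I) ^ e"
    proof (cases e)
      case 0
      \<comment> \<open>At most one generator: the kernel is the zero space, where the remaining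
        functionals vanish, so the restriction contributes nothing.\<close>
      then have "B' = {}" using B' insert.prems by simp
      moreover obtain j where "j \<in> I" using insert.hyps by blast
      ultimately have "sign_patterns h I (span B') = {}"
        using linear_0[of "h j"] insert.prems by (auto simp: sign_patterns_def)
      then show ?thesis using insert.IH[of B 0] insert.prems 0 by simp
    next
      case (Suc d)
      have "card (sign_patterns h I (span B)) + card (sign_patterns h I (span B'))
            \<le> 2 * card I ^ Suc d + 2 * card I ^ d"
        using insert.IH[of B e] insert.IH[of B' d] insert.prems B' Suc by (intro add_mono) auto
      also have "\<dots> = 2 * (card I ^ d * Suc (card I))" by simp
      also have "\<dots> \<le> 2 * (Suc (card I) ^ d * Suc (card I))"
        by (intro mult_le_mono power_mono) auto
      finally show ?thesis using Suc insert.hyps by (simp add: algebra_simps)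
    qed
    finally show ?thesis .
  qed
qed

section \<open>Generic points\<close>

definition proper_subsets :: "nat \<Rightarrow> nat set set" where
  "proper_subsets n = {S. S \<noteq> {} \<and> S \<subset> {1..n + 1}}"

definition generic_points :: "nat \<Rightarrow> (nat \<Rightarrow> real) set" where
  "generic_points n = {x \<in> V_empty n. \<forall>S\<in>proper_subsets n. sum x S \<noteq> 0}"

text \<open>Combinatorial name of the resonance chamber of a generic \<open>x\<close>. No sum over a
  proper subset vanishes there, so recording the positive ones records all signs.\<close>

definition positive_sets :: "nat \<Rightarrow> (nat \<Rightarrow> real) \<Rightarrow> nat set set" where
  "positive_sets n x = {S \<in> proper_subsets n. 0 < sum x S}"

lemma finite_proper_subsets: "finite (proper_subsets n)"
  by (rule finite_subset[of _ "Pow {1..n + 1}"]) (auto simp: proper_subsets_def)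

lemma finite_positive_sets_image: "finite (positive_sets n ` X)"
  by (rule finite_subset[of _ "Pow (proper_subsets n)"])
    (auto simp: positive_sets_def finite_proper_subsets)

lemma linear_sum_eval: "linear (\<lambda>x :: 'a \<Rightarrow> real. sum x S)"
  by (intro linearI) (simp_all add: sum.distrib scaleR_fun_def sum_distrib_left)

lemma subspace_V_empty: "subspace (V_empty n)"
  unfolding V_empty_def
  by (auto simp: subspace_def sum.distrib scaleR_fun_def simp del: sum.cl_ivl_Suc simp flip: sum_distrib_left)

lemma sum_fun_apply: "(\<Sum>a\<in>A. g a) k = (\<Sum>a\<in>A. g a k)"
  by (induction A rule: infinite_finite_induct) auto

lemma sum_basis_vec: "finite S \<Longrightarrow> sum (basis_vec i) S = (if i \<in> S then 1 else 0)"
  by (simp add: basis_vec_def)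

lemma basis_vec_diff_in_V_empty:
  "\<lbrakk>i \<in> {1..n + 1}; j \<in> {1..n + 1}\<rbrakk> \<Longrightarrow> basis_vec i - basis_vec j \<in> V_empty n"
  by (auto simp: V_empty_def sum_subtractf sum_basis_vec) (auto simp: basis_vec_def)

lemma V_empty_expand:
  assumes "x \<in> V_empty n"
  shows "x = (\<Sum>i\<in>{1..n}. x i *\<^sub>R (basis_vec i - basis_vec (n + 1)))"
proof
  fix k
  have last: "x (n + 1) = - (\<Sum>i\<in>{1..n}. x i)" using assms by (simp add: V_empty_def)
  have "(\<Sum>i\<in>{1..n}. x i *\<^sub>R (basis_vec i - basis_vec (n + 1))) k
      = (\<Sum>i\<in>{1..n}. if k = i then x i else 0) - (if k = n + 1 then \<Sum>i\<in>{1..n}. x i else 0)"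
    by (auto simp: sum_fun_apply scaleR_fun_def basis_vec_def sum_subtractf right_diff_distrib
        if_distrib[of "\<lambda>a. _ * a"] cong: if_cong sum.cong)
  also have "\<dots> = x k" using last assms by (auto simp: V_empty_def)
  finally show "x k = (\<Sum>i\<in>{1..n}. x i *\<^sub>R (basis_vec i - basis_vec (n + 1))) k" by simp
qed

lemma V_empty_eq_span: "V_empty n = span ((\<lambda>i. basis_vec i - basis_vec (n + 1)) ` {1..n})"
proof (intro equalityI subsetI)
  fix x assume "x \<in> V_empty n"
  have "(\<Sum>i\<in>{1..n}. x i *\<^sub>R (basis_vec i - basis_vec (n + 1)))
      \<in> span ((\<lambda>i. basis_vec i - basis_vec (n + 1)) ` {1..n})"
    by (intro span_sum span_scale span_base imageI)
  then show "x \<in> span ((\<lambda>i. basis_vec i - basis_vec (n + 1)) ` {1..n})"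
    using V_empty_expand[OF \<open>x \<in> V_empty n\<close>] by simp
next
  fix x assume "x \<in> span ((\<lambda>i. basis_vec i - basis_vec (n + 1)) ` {1..n})"
  moreover have "(\<lambda>i. basis_vec i - basis_vec (n + 1)) ` {1..n} \<subseteq> V_empty n"
    by (auto intro!: basis_vec_diff_in_V_empty)
  ultimately show "x \<in> V_empty n" using span_minimal subspace_V_empty by blast
qed

lemma generic_points_eq: "generic_points n = V_empty n - \<Union> (resonance_arrangement n)"
  by (auto simp: generic_points_def resonance_arrangement_def resonance_hyperplane_def
      proper_subsets_def)

section \<open>Sign classes, full dimension and generic points\<close>

lemma positive_sets_eqD:
  assumes "x \<in> generic_points n" "y \<in> generic_points n" "positive_sets n x = positive_sets n y"
    and "S \<in> proper_subsets n"
  shows "0 < sum x S * sum y S" "0 < sum x S \<longleftrightarrow> 0 < sum y S"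
proof -
  show iff: "0 < sum x S \<longleftrightarrow> 0 < sum y S"
    using assms(3,4) by (auto simp: positive_sets_def)
  have "sum x S \<noteq> 0" "sum y S \<noteq> 0" using assms by (auto simp: generic_points_def)
  with iff show "0 < sum x S * sum y S" by (auto simp: zero_less_mult_iff)
qed

text \<open>Openness of a sign class along a line: finitely many strict inequalities hold at t = 0
  and persist for small positive t.\<close>

lemma generic_point_scaled_shift:
  assumes "x \<in> generic_points n" "v \<in> V_empty n"
  obtains t where "0 < t" "x + t *\<^sub>R v \<in> generic_points n"
    "positive_sets n (x + t *\<^sub>R v) = positive_sets n x"
proof -
  \<comment> \<open>A positive product expresses at once that the new sum is nonzero and has the old
    sign. Its limit at 0 is the square of a nonzero number.\<close>
  have "\<forall>\<^sub>F t in at_right 0. 0 < sum x S * (sum x S + t * sum v S)" if "S \<in> proper_subsets n" for S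
  proof -
    have "((\<lambda>t. sum x S * (sum x S + t * sum v S)) \<longlongrightarrow> sum x S * (sum x S + 0 * sum v S)) (at_right 0)"
      by (intro tendsto_intros)
    moreover have "0 < sum x S * (sum x S + 0 * sum v S)"
    proof -
      have "sum x S \<noteq> 0" using assms(1) that by (simp add: generic_points_def)
      then show ?thesis by (auto simp: zero_less_mult_iff linorder_neq_iff)
    qed
    ultimately show ?thesis by (rule order_tendstoD)
  qed
  then have "\<forall>\<^sub>F t in at_right 0. \<forall>S\<in>proper_subsets n. 0 < sum x S * (sum x S + t * sum v S)"
    by (intro eventually_ball_finite finite_proper_subsets) auto
  moreover have "\<forall>\<^sub>F t :: real in at_right 0. 0 < t"
    by (simp add: eventually_at_right_less)
  ultimately have "\<forall>\<^sub>F t in at_right 0.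
      0 < t \<and> (\<forall>S\<in>proper_subsets n. 0 < sum x S * (sum x S + t * sum v S))"
    by eventually_elim auto
  then obtain t :: real where t: "0 < t"
    "\<And>S. S \<in> proper_subsets n \<Longrightarrow> 0 < sum x S * (sum x S + t * sum v S)"
    using eventually_happens[of _ "at_right (0::real)"] trivial_limit_at_right_real by blast
  have eq: "sum (x + t *\<^sub>R v) S = sum x S + t * sum v S" for S
    by (simp add: sum.distrib scaleR_fun_def sum_distrib_left)
  have "x + t *\<^sub>R v \<in> generic_points n"
  proof -
    have "x + t *\<^sub>R v \<in> V_empty n"
      using assms by (intro subspace_add subspace_scale subspace_V_empty) (simp_all add: generic_points_def)
    moreover have "sum (x + t *\<^sub>R v) S \<noteq> 0" if "S \<in> proper_subsets n" for S
      unfolding eq using t(2)[OF that] by (metis less_irrefl mult_zero_right)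
    ultimately show ?thesis by (simp add: generic_points_def)
  qed
  moreover have "positive_sets n (x + t *\<^sub>R v) = positive_sets n x"
  proof -
    have "0 < sum x S + t * sum v S \<longleftrightarrow> 0 < sum x S" if "S \<in> proper_subsets n" for S
      using t(2)[OF that] by (metis less_asym zero_less_mult_iff)
    then show ?thesis unfolding positive_sets_def eq by blast
  qed
  ultimately show ?thesis using that t(1) by blast
qed

text \<open>Every direction \<open>v\<close> is a multiple of the difference of two points of the
  sign class, so \<open>X\<close> spans the whole space.\<close>

lemma full_dim_if_contains_sign_class:
  assumes "x \<in> generic_points n" "X \<subseteq> V_empty n"
    and "\<And>y. \<lbrakk>y \<in> generic_points n; positive_sets n y = positive_sets n x\<rbrakk> \<Longrightarrow> y \<in> X"
  shows "dim X = dim (V_empty n)"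
proof -
  have "V_empty n \<subseteq> span X"
  proof
    fix v assume "v \<in> V_empty n"
    then obtain t where t: "0 < t" "x + t *\<^sub>R v \<in> X"
      using generic_point_scaled_shift[OF assms(1)] assms(3) by metis
    have "x \<in> X" using assms(1,3) by blast
    then have "(1 / t) *\<^sub>R ((x + t *\<^sub>R v) - x) \<in> span X"
      using t(2) by (intro span_scale span_diff span_base)
    then show "v \<in> span X" using t(1) by simp
  qed
  moreover have "span X \<subseteq> V_empty n" using assms(2) subspace_V_empty by (rule span_minimal)
  ultimately show ?thesis by (metis real_vector.dim_span subset_antisym)
qed

text \<open>The ambient function space is infinite-dimensional, so equality of dimensions has to be
  compared through finite bases: a vector outside \<open>span X\<close> would extend a basis of
  \<open>X\<close> to an independent set larger than a basis of \<open>V_empty n\<close>.\<close>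

lemma full_dim_spans:
  assumes "X \<subseteq> V_empty n" "dim X = dim (V_empty n)"
  shows "V_empty n \<subseteq> span X"
proof
  fix v assume v: "v \<in> V_empty n"
  obtain B where B: "B \<subseteq> X" "independent B" "X \<subseteq> span B" "card B = dim X"
    using real_vector.basis_exists by blast
  obtain C where C: "C \<subseteq> V_empty n" "independent C" "V_empty n \<subseteq> span C" "card C = dim (V_empty n)"
    using real_vector.basis_exists by blast
  have "finite C"
    using real_vector.independent_span_bound[of "(\<lambda>i. basis_vec i - basis_vec (n + 1)) ` {1..n}" C] C
    unfolding V_empty_eq_span by blast
  show "v \<in> span X"
  proof (rule ccontr)
    assume "v \<notin> span X"
    then have "v \<notin> span B" using B(1) span_mono by blast
    then have "independent (insert v B)" "v \<notin> B"
      using real_vector.independent_insertI[OF _ B(2)] span_base[of v B] by blast+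
    moreover have "insert v B \<subseteq> span C" using v B(1) assms(1) C(3) by blast
    ultimately have "finite (insert v B) \<and> card (insert v B) \<le> card C"
      by (intro real_vector.independent_span_bound[OF \<open>finite C\<close>])
    then show False using B(4) C(4) assms(2) \<open>v \<notin> B\<close> by auto
  qed
qed

text \<open>A convex cone is not covered by finitely many hyperplanes unless one of them contains
  it. Moving from a point \<open>x\<close> good for \<open>F\<close> in a direction \<open>y\<close>
  good for \<open>h\<close>, each functional excludes at most one value of the step size t.\<close>

lemma exists_avoiding_functionals:
  fixes K :: "'v::real_vector set"
  assumes "finite F" "K \<noteq> {}"
    and add: "\<And>x y. \<lbrakk>x \<in> K; y \<in> K\<rbrakk> \<Longrightarrow> x + y \<in> K"
    and scale: "\<And>x t. \<lbrakk>x \<in> K; 0 \<le> t\<rbrakk> \<Longrightarrow> t *\<^sub>R x \<in> K"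
    and "\<And>h. h \<in> F \<Longrightarrow> linear h \<and> (\<exists>y\<in>K. h y \<noteq> (0::real))"
  shows "\<exists>x\<in>K. \<forall>h\<in>F. h x \<noteq> 0"
  using assms(1,5)
proof (induction F rule: finite_induct)
  case empty
  then show ?case using assms(2) by blast
next
  case (insert h F)
  obtain x where x: "x \<in> K" "\<And>g. g \<in> F \<Longrightarrow> g x \<noteq> 0" using insert by blast
  obtain y where y: "y \<in> K" "h y \<noteq> 0" using insert by blast
  define bad where "bad = insert 0 ((\<lambda>g. - g x / g y) ` insert h F)"
  have "finite bad" using insert.hyps by (simp add: bad_def)
  then have "\<not> {0<..} \<subseteq> bad" using infinite_Ioi[of "0::real"] finite_subset by blast
  then obtain t where t: "0 < t" "t \<notin> bad" by auto
  have "g (x + t *\<^sub>R y) \<noteq> 0" if "g \<in> insert h F" for g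
  proof
    assume "g (x + t *\<^sub>R y) = 0"
    moreover have "linear g" using insert.prems that by blast
    ultimately have *: "g x + t * g y = 0" by (simp add: linear_add linear_cmul)
    show False
    proof (cases "g y = 0")
      case True
      then show False using * x(2) y(2) that by auto
    next
      case False
      then have "t = - g x / g y" using * by (simp add: field_simps)
      then show False using t(2) that by (auto simp: bad_def)
    qed
  qed
  moreover have "x + t *\<^sub>R y \<in> K" using add scale x(1) y(1) t(1) by simp
  ultimately show ?case by blast
qed

text \<open>If a coordinate sum over \<open>S\<close> vanished on \<open>X\<close>, it would vanish
  on the span, hence on \<open>basis_vec i - basis_vec j\<close> with \<open>i\<close> in
  \<open>S\<close> and \<open>j\<close> outside, where it equals 1.\<close>

lemma full_dim_cone_has_generic_point:
  assumes "X \<subseteq> V_empty n" "dim X = dim (V_empty n)" "X \<noteq> {}"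
    and add: "\<And>x y. \<lbrakk>x \<in> X; y \<in> X\<rbrakk> \<Longrightarrow> x + y \<in> X"
    and scale: "\<And>x t. \<lbrakk>x \<in> X; 0 \<le> t\<rbrakk> \<Longrightarrow> t *\<^sub>R x \<in> X"
  shows "\<exists>x\<in>X. x \<in> generic_points n"
proof -
  have "\<exists>y\<in>X. sum y S \<noteq> 0" if S: "S \<in> proper_subsets n" for S
  proof (rule ccontr)
    assume "\<not> ?thesis"
    then have "X \<subseteq> {y. sum y S = 0}" by blast
    then have "span X \<subseteq> {y. sum y S = 0}"
      using linear_subspace_kernel[OF linear_sum_eval] by (rule span_minimal)
    moreover obtain i j where ij: "i \<in> S" "i \<in> {1..n + 1}" "j \<in> {1..n + 1}" "j \<notin> S"
      using S unfolding proper_subsets_def by blast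
    ultimately have "sum (basis_vec i - basis_vec j) S = 0"
      using full_dim_spans[OF assms(1,2)] basis_vec_diff_in_V_empty by blast
    moreover have "finite S" using S finite_subset by (auto simp: proper_subsets_def)
    ultimately show False using ij by (simp add: sum_subtractf sum_basis_vec)
  qed
  then have "linear h \<and> (\<exists>y\<in>X. h y \<noteq> 0)" if "h \<in> (\<lambda>S x. sum x S) ` proper_subsets n" for h
    using that linear_sum_eval by blast
  with assms(3) have "\<exists>x\<in>X. \<forall>h\<in>(\<lambda>S x. sum x S) ` proper_subsets n. h x \<noteq> 0"
    by (intro exists_avoiding_functionals finite_imageI finite_proper_subsets add scale) auto
  then show ?thesis using assms(1) by (auto simp: generic_points_def)
qed

section \<open>Root cones of trees\<close>

text \<open>Reading \<open>f\<close> as a flow along the arcs, this is the vector of outflow minus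
  inflow at each vertex. A root cone consists of the vectors arising from nonnegative flows.\<close>

definition flow_net :: "nat rel \<Rightarrow> (nat \<times> nat \<Rightarrow> real) \<Rightarrow> nat \<Rightarrow> real" where
  "flow_net E f = (\<Sum>a\<in>E. f a *\<^sub>R (basis_vec (fst a) - basis_vec (snd a)))"

lemma root_cone_eq: "root_cone E = {flow_net E f |f. \<forall>a\<in>E. 0 \<le> f a}"
  by (simp add: root_cone_def flow_net_def split_def)

lemma root_coneI: "(\<And>a. a \<in> E \<Longrightarrow> 0 \<le> f a) \<Longrightarrow> flow_net E f \<in> root_cone E"
  by (auto simp: root_cone_eq)

lemma flow_net_add: "flow_net E f + flow_net E g = flow_net E (\<lambda>a. f a + g a)"
  by (simp add: flow_net_def scaleR_add_left sum.distrib)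

lemma flow_net_scale: "c *\<^sub>R flow_net E f = flow_net E (\<lambda>a. c * f a)"
  by (simp add: flow_net_def scaleR_sum_right)

lemma flow_net_in_V_empty:
  assumes "E \<subseteq> {1..n + 1} \<times> {1..n + 1}"
  shows "flow_net E f \<in> V_empty n"
  unfolding flow_net_def using assms
  by (intro subspace_sum subspace_scale subspace_V_empty basis_vec_diff_in_V_empty)
    (auto simp del: add_Suc_right)

text \<open>Arcs inside or outside \<open>S\<close> cancel: the sum is the flow leaving
  \<open>S\<close> minus the flow entering it.\<close>

lemma sum_flow_net:
  assumes "finite S"
  shows "sum (flow_net E f) S
    = (\<Sum>a\<in>E. f a * ((if fst a \<in> S then 1 else 0) - (if snd a \<in> S then 1 else 0)))"
proof -
  have "flow_net E f = (\<lambda>k. \<Sum>a\<in>E. (f a *\<^sub>R (basis_vec (fst a) - basis_vec (snd a))) k)"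
    by (rule ext) (simp only: flow_net_def sum_fun_apply)
  then have "sum (flow_net E f) S = (\<Sum>a\<in>E. \<Sum>k\<in>S. (f a *\<^sub>R (basis_vec (fst a) - basis_vec (snd a))) k)"
    by (simp only: sum.swap[of _ E S])
  also have "(\<lambda>a. \<Sum>k\<in>S. (f a *\<^sub>R (basis_vec (fst a) - basis_vec (snd a))) k)
      = (\<lambda>a. f a * ((if fst a \<in> S then 1 else 0) - (if snd a \<in> S then 1 else 0)))"
    using assms by (simp add: scaleR_fun_def sum_subtractf sum_basis_vec flip: sum_distrib_left)
  finally show ?thesis .
qed

lemma root_cone_add:
  assumes "x \<in> root_cone E" "y \<in> root_cone E"
  shows "x + y \<in> root_cone E"
proof -
  obtain f g where "x = flow_net E f" "\<forall>a\<in>E. 0 \<le> f a" "y = flow_net E g" "\<forall>a\<in>E. 0 \<le> g a"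
    using assms by (auto simp: root_cone_eq)
  then show ?thesis by (auto simp: flow_net_add intro!: root_coneI)
qed

lemma root_cone_scale:
  assumes "x \<in> root_cone E" "0 \<le> t"
  shows "t *\<^sub>R x \<in> root_cone E"
proof -
  obtain f where "x = flow_net E f" "\<forall>a\<in>E. 0 \<le> f a" using assms(1) by (auto simp: root_cone_eq)
  then show ?thesis using assms(2) by (auto simp: flow_net_scale intro!: root_coneI)
qed

lemma zero_in_root_cone: "0 \<in> root_cone E"
proof -
  have "flow_net E (\<lambda>a. 0) \<in> root_cone E" by (rule root_coneI) simp
  then show ?thesis by (simp add: flow_net_def)
qed

lemma root_cone_subset_V_empty:
  "E \<subseteq> {1..n + 1} \<times> {1..n + 1} \<Longrightarrow> root_cone E \<subseteq> V_empty n"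
  using flow_net_in_V_empty by (auto simp: root_cone_eq)

lemma flow_net_single:
  assumes "finite E" "(i, j) \<in> E"
  shows "flow_net E (\<lambda>a. if a = (i, j) then c else 0) = c *\<^sub>R (basis_vec i - basis_vec j)"
proof -
  have "flow_net E (\<lambda>a. if a = (i, j) then c else 0)
      = (\<Sum>a\<in>E. if a = (i, j) then c *\<^sub>R (basis_vec i - basis_vec j) else 0)"
    unfolding flow_net_def by (intro sum.cong) auto
  then show ?thesis using assms by simp
qed

section \<open>Flows and cuts in trees\<close>

lemma connected_flow_net_path:
  assumes "finite E" "(u, v) \<in> (E \<union> E\<inverse>)\<^sup>*"
  shows "\<exists>f. basis_vec u - basis_vec v = flow_net E f"
  using assms(2)
proof (induction rule: rtrancl_induct)
  case base
  have "flow_net E (\<lambda>a. 0) = 0" by (simp add: flow_net_def)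
  then show ?case by (metis diff_self)
next
  case (step v w)
  obtain f where f: "basis_vec u - basis_vec v = flow_net E f" using step.IH by blast
  have "\<exists>g. basis_vec v - basis_vec w = flow_net E g"
  proof (cases "(v, w) \<in> E")
    case True
    then show ?thesis using flow_net_single[OF assms(1) True, of 1] by (metis scaleR_one)
  next
    case False
    \<comment> \<open>An arc walked backwards carries flow -1, so the flows obtained here have no
      sign constraint.\<close>
    then have "(w, v) \<in> E" using step.hyps by blast
    then show ?thesis using flow_net_single[OF assms(1), of w v "-1"]
      by (metis minus_diff_eq scaleR_minus1_left)
  qed
  then obtain g where g: "basis_vec v - basis_vec w = flow_net E g" by blast
  have "basis_vec u - basis_vec w = flow_net E f + flow_net E g"
    unfolding f[symmetric] g[symmetric] by simp
  then show ?case unfolding flow_net_add by blast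
qed

text \<open>Connectedness alone lets every vector of the space be written as a signed flow; lying in
  the root cone then becomes a question about the signs of the coefficients.\<close>

lemma connected_flow_net_surj:
  assumes "finite E" "undirected_connected {1..n + 1} E" "y \<in> V_empty n"
  shows "\<exists>f. y = flow_net E f"
proof -
  let ?U = "range (flow_net E)"
  have "subspace ?U"
    unfolding subspace_def
  proof (intro conjI ballI allI)
    have "flow_net E (\<lambda>a. 0) = 0" by (simp add: flow_net_def)
    then show "0 \<in> ?U" by (metis rangeI)
  qed (auto simp: flow_net_add flow_net_scale)
  moreover have "(\<lambda>i. basis_vec i - basis_vec (n + 1)) ` {1..n} \<subseteq> ?U"
  proof (intro image_subsetI)
    fix i assume "i \<in> {1..n}"
    then have "(i, n + 1) \<in> (E \<union> E\<inverse>)\<^sup>*"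
      using assms(2) by (simp add: undirected_connected_def)
    then show "basis_vec i - basis_vec (n + 1) \<in> ?U"
      using connected_flow_net_path[OF assms(1)] by blast
  qed
  ultimately have "V_empty n \<subseteq> ?U" unfolding V_empty_eq_span using span_minimal by blast
  then show ?thesis using assms(3) by blast
qed

text \<open>Cycles are lists of distinct vertices, so walks must be made simple: when a step returns
  to a visited vertex, the path is cut back to it.\<close>

lemma rtrancl_simple_path:
  assumes "(u, v) \<in> R\<^sup>*"
  obtains p where "p \<noteq> []" "distinct p" "hd p = u" "last p = v"
    "successively (\<lambda>a b. (a, b) \<in> R) p"
proof -
  have "\<exists>p. p \<noteq> [] \<and> distinct p \<and> hd p = u \<and> last p = v \<and> successively (\<lambda>a b. (a, b) \<in> R) p"
    using assms
  proof (induction rule: rtrancl_induct)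
    case base
    show ?case by (rule exI[of _ "[u]"]) simp
  next
    case (step v w)
    then obtain p where p: "p \<noteq> []" "distinct p" "hd p = u" "last p = v"
      "successively (\<lambda>a b. (a, b) \<in> R) p" by blast
    show ?case
    proof (cases "w \<in> set p")
      case True
      then obtain q r where "p = q @ w # r" by (meson split_list)
      then have qr: "p = (q @ [w]) @ r" by simp
      then have "successively (\<lambda>a b. (a, b) \<in> R) (q @ [w])"
        using p(5) by (simp only: successively_append_iff)
      moreover have "hd (q @ [w]) = u" using p(3) unfolding qr by (cases q) simp_all
      ultimately show ?thesis using p(2) qr
        by (intro exI[of _ "q @ [w]"]) simp
    next
      case False
      then show ?thesis using p step.hyps
        by (intro exI[of _ "p @ [w]"]) (auto simp: successively_append_iff)
    qed
  qed
  then show ?thesis using that by blast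
qed

text \<open>A simple path from \<open>i\<close> to \<open>j\<close> that avoids the arc closes up
  with it to a cycle.\<close>

lemma tree_edge_is_bridge:
  assumes "\<nexists>p. undirected_cycle E p" "(i, j) \<in> E" "\<And>a b. (a, b) \<in> E \<Longrightarrow> a < (b::'a::order)"
  shows "(i, j) \<notin> ((E - {(i, j)}) \<union> (E - {(i, j)})\<inverse>)\<^sup>*"
proof
  let ?R = "(E - {(i, j)}) \<union> (E - {(i, j)})\<inverse>"
  assume "(i, j) \<in> ?R\<^sup>*"
  then obtain p where p: "p \<noteq> []" "distinct p" "hd p = i" "last p = j"
    "successively (\<lambda>a b. (a, b) \<in> ?R) p" by (rule rtrancl_simple_path)
  have ij: "i < j" using assms(2,3) by blast
  \<comment> \<open>The order on the arcs rules out the opposite arc \<open>(j, i)\<close>; hence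
    the path is no single step and the cycle has at least three vertices.\<close>
  then have nij: "(i, j) \<notin> ?R" using assms(3)[of j i] by auto
  have len: "3 \<le> length p"
  proof (rule ccontr)
    assume "\<not> 3 \<le> length p"
    then consider a where "p = [a]" | a b where "p = [a, b]"
      using p(1) by (cases p; cases "tl p"; cases "tl (tl p)") auto
    then show False using p ij nij by cases auto
  qed
  have "(p ! k, p ! (Suc k mod length p)) \<in> E \<union> E\<inverse>" if k: "k < length p" for k
  proof (cases "Suc k = length p")
    case True
    then have "p ! k = j" "p ! (Suc k mod length p) = i"
      using p(1,3,4) by (auto simp: last_conv_nth hd_conv_nth simp flip: True)
    then show ?thesis using assms(2) by simp
  next
    case False
    then have "Suc k < length p" using k by simp
    then have "(p ! k, p ! Suc k) \<in> ?R" using p(5) unfolding successively_conv_nth by blast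
    then show ?thesis using \<open>Suc k < length p\<close> by auto
  qed
  then have "undirected_cycle E p" using len p(2) by (simp add: undirected_cycle_def)
  then show False using assms(1) by blast
qed

text \<open>
  Deleting an arc \<open>e\<close> of a tree leaves a component \<open>S\<close> whose only boundary arc is \<open>e\<close>, so the
  coordinate sum over \<open>S\<close> recovers the coefficient of \<open>e\<close>.
\<close>

lemma tree_cut:
  assumes T: "positive_alternating_tree n E" and "e \<in> E"
  obtains S where "S \<in> proper_subsets n" "\<And>f. sum (flow_net E f) S = f e"
proof -
  obtain i j where e: "e = (i, j)" by force
  let ?R = "(E - {(i, j)}) \<union> (E - {(i, j)})\<inverse>"
  \<comment> \<open>The side of the tail \<open>i\<close> is taken, so that \<open>e\<close> leaves
    \<open>S\<close> and the sum is \<open>f e\<close> rather than its negative.\<close>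
  define S where "S = {v \<in> {1..n + 1}. (i, v) \<in> ?R\<^sup>*}"
  have E: "E \<subseteq> {1..n + 1} \<times> {1..n + 1}" using T by (simp add: positive_alternating_tree_def)
  then have "finite E" by (rule finite_subset) simp
  have ij: "i \<in> {1..n + 1}" "j \<in> {1..n + 1}" using E e assms(2) by auto
  have "i \<in> S" using ij by (simp add: S_def)
  have "j \<notin> S"
  proof -
    have "(i, j) \<notin> ?R\<^sup>*"
    proof (rule tree_edge_is_bridge)
      show "\<nexists>p. undirected_cycle E p" "\<And>a b. (a, b) \<in> E \<Longrightarrow> a < b"
        using T by (auto simp: positive_alternating_tree_def underlying_tree_def)
      show "(i, j) \<in> E" using assms(2) e by simp
    qed
    then show ?thesis by (simp add: S_def)
  qed
  have same: "fst a \<in> S \<longleftrightarrow> snd a \<in> S" if "a \<in> E - {e}" for a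
  proof -
    have a: "(fst a, snd a) \<in> ?R" "(snd a, fst a) \<in> ?R" using that e by (auto simp: prod_eq_iff)
    have "(i, fst a) \<in> ?R\<^sup>* \<longleftrightarrow> (i, snd a) \<in> ?R\<^sup>*"
    proof
      show "(i, snd a) \<in> ?R\<^sup>*" if "(i, fst a) \<in> ?R\<^sup>*" using that a(1) by (rule rtrancl_into_rtrancl)
      show "(i, fst a) \<in> ?R\<^sup>*" if "(i, snd a) \<in> ?R\<^sup>*" using that a(2) by (rule rtrancl_into_rtrancl)
    qed
    moreover have "fst a \<in> {1..n + 1}" "snd a \<in> {1..n + 1}" using E that by auto
    ultimately show ?thesis
      unfolding S_def by simp
  qed
  have "finite S" by (simp add: S_def)
  have "sum (flow_net E f) S = f e" for f
  proof -
    have "sum (flow_net E f) S = (\<Sum>a\<in>E. if a = e then f e else 0)"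
      unfolding sum_flow_net[OF \<open>finite S\<close>]
    proof (rule sum.cong[OF refl])
      fix a assume "a \<in> E"
      show "f a * ((if fst a \<in> S then 1 else 0) - (if snd a \<in> S then 1 else 0)) = (if a = e then f e else 0)"
        using same[of a] \<open>a \<in> E\<close> \<open>i \<in> S\<close> \<open>j \<notin> S\<close> e by (cases "a = e") simp_all
    qed
    then show ?thesis using \<open>finite E\<close> assms(2) by simp
  qed
  moreover have "S \<in> proper_subsets n"
  proof -
    have "S \<subseteq> {1..n + 1}" unfolding S_def by (rule Collect_subset)
    then show ?thesis using \<open>i \<in> S\<close> \<open>j \<notin> S\<close> ij unfolding proper_subsets_def by blast
  qed
  ultimately show ?thesis using that by blast
qed

text \<open>The cut of each arc reads off its coefficient in both \<open>x\<close> and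
  \<open>y\<close> as a sum over one proper subset. These sums have the same nonzero sign, so
  nonnegative coefficients of \<open>x\<close> force positive ones for \<open>y\<close>.\<close>

lemma root_cone_sign_determined:
  assumes T: "positive_alternating_tree n E" and x: "x \<in> root_cone E" "x \<in> generic_points n"
    and y: "y \<in> generic_points n" "positive_sets n y = positive_sets n x"
  shows "y \<in> root_cone E"
proof -
  have "finite E"
    by (rule finite_subset[of _ "{1..n + 1} \<times> {1..n + 1}"])
      (use T in \<open>simp_all add: positive_alternating_tree_def\<close>)
  then obtain g where g: "y = flow_net E g"
    using connected_flow_net_surj[of E n y] T y(1)
    by (auto simp: positive_alternating_tree_def underlying_tree_def generic_points_def)
  obtain f where f: "x = flow_net E f" "\<forall>a\<in>E. 0 \<le> f a" using x(1) by (auto simp: root_cone_eq)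
  have "0 \<le> g a" if a: "a \<in> E" for a
  proof -
    obtain S where S: "S \<in> proper_subsets n" "\<And>f. sum (flow_net E f) S = f a"
      using tree_cut[OF T a] by blast
    have "0 < sum x S * sum y S" using positive_sets_eqD(1)[OF x(2) y(1) y(2)[symmetric] S(1)] .
    then have "0 < f a * g a" unfolding f(1) g S(2) .
    then show ?thesis using f(2) a by (auto simp: zero_less_mult_iff)
  qed
  then show ?thesis unfolding g by (rule root_coneI)
qed

text \<open>Arcs increase, so an arc can leave an initial segment but never enter it.\<close>

lemma root_cone_prefix_sum_nonneg:
  assumes "positive_alternating_tree n E" "x \<in> root_cone E"
  shows "0 \<le> sum x {1..k}"
proof -
  obtain f where f: "x = flow_net E f" "\<forall>a\<in>E. 0 \<le> f a" using assms(2) by (auto simp: root_cone_eq)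
  have "0 \<le> f a * ((if fst a \<in> {1..k} then 1 else 0) - (if snd a \<in> {1..k} then 1 else 0))"
    if "a \<in> E" for a
  proof -
    have "fst a < snd a" "1 \<le> fst a"
      using assms(1) that by (auto simp: positive_alternating_tree_def)
    then show ?thesis using f(2) that by auto
  qed
  then show ?thesis unfolding f(1) by (subst sum_flow_net) (auto intro!: sum_nonneg)
qed

section \<open>Resonance chambers and sign classes\<close>

text \<open>A sign class is convex, so the segment from \<open>x\<close> to \<open>y\<close> stays
  generic.\<close>

lemma same_signs_imp_connected_component:
  assumes x: "x \<in> generic_points n" and y: "y \<in> generic_points n"
    and eq: "positive_sets n x = positive_sets n y"
  shows "connected_component (generic_points n) x y"
proof -
  define p where "p t = (1 - t) *\<^sub>R x + t *\<^sub>R y" for t :: real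
  have "continuous_on {0..1} p"
    unfolding p_def
    by (rule continuous_on_coordinatewise_then_product) (auto simp: scaleR_fun_def intro!: continuous_intros)
  then have "connected (p ` {0..1})" by (intro connected_continuous_image connected_Icc)
  moreover have "p ` {0..1} \<subseteq> generic_points n"
  proof (intro image_subsetI)
    fix t :: real assume t: "t \<in> {0..1}"
    have "p t \<in> V_empty n"
      using x y unfolding p_def
      by (intro subspace_add subspace_scale subspace_V_empty) (simp_all add: generic_points_def)
    moreover have "sum (p t) S \<noteq> 0" if S: "S \<in> proper_subsets n" for S
    proof -
      have "sum (p t) S = (1 - t) * sum x S + t * sum y S"
        by (simp add: p_def sum.distrib scaleR_fun_def sum_distrib_left)
      moreover consider "0 < sum x S" "0 < sum y S" | "sum x S < 0" "sum y S < 0"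
        using positive_sets_eqD(1)[OF x y eq S] by (auto simp: zero_less_mult_iff)
      then have "(1 - t) * sum x S + t * sum y S \<noteq> 0"
      proof cases
        case 1
        \<comment> \<open>At t = 0 strictness comes from \<open>x\<close>; for t > 0 the term of
          \<open>y\<close> is strictly positive.\<close>
        then show ?thesis using t
          by (cases "t = 0") (auto intro!: add_nonneg_pos less_imp_neq[THEN not_sym])
      next
        case 2
        then show ?thesis using t
          by (cases "t = 0") (auto intro!: add_nonpos_neg less_imp_neq simp: mult_nonneg_nonpos mult_pos_neg)
      qed
      ultimately show ?thesis by simp
    qed
    ultimately show "p t \<in> generic_points n" by (simp add: generic_points_def)
  qed
  moreover have "x \<in> p ` {0..1}" "y \<in> p ` {0..1}"
    by (rule image_eqI[of _ _ 0]; simp add: p_def) (rule image_eqI[of _ _ 1]; simp add: p_def)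
  ultimately show ?thesis unfolding connected_component_def by blast
qed

text \<open>Each coordinate sum is continuous and avoids 0 on \<open>T\<close>, so it cannot change
  sign there. Exchanging \<open>x\<close> and \<open>y\<close> gives equality.\<close>

lemma connected_imp_positive_sets_subset:
  assumes "connected T" "T \<subseteq> generic_points n" "x \<in> T" "y \<in> T"
  shows "positive_sets n x \<subseteq> positive_sets n y"
proof
  fix S assume S: "S \<in> positive_sets n x"
  then have S': "S \<in> proper_subsets n" "0 < sum x S" by (auto simp: positive_sets_def)
  have "continuous_on T (\<lambda>z. \<Sum>i\<in>S. z i)"
    by (intro continuous_on_sum continuous_on_subset[OF continuous_on_product_coordinates]) simp
  then have "connected ((\<lambda>z. sum z S) ` T)" using assms(1) by (rule connected_continuous_image)
  moreover have "0 \<notin> (\<lambda>z. sum z S) ` T"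
    using assms(2) S'(1) by (auto simp: generic_points_def)
  ultimately have "\<not> sum y S \<le> 0"
    using connectedD_interval[of "(\<lambda>z. sum z S) ` T" "sum y S" "sum x S" 0] assms(3,4) S'(2) by auto
  then show "S \<in> positive_sets n y" using S'(1) by (simp add: positive_sets_def)
qed

lemma connected_component_generic_iff:
  assumes "x \<in> generic_points n" "y \<in> generic_points n"
  shows "connected_component_set (generic_points n) x = connected_component_set (generic_points n) y
    \<longleftrightarrow> positive_sets n x = positive_sets n y"
proof
  assume "positive_sets n x = positive_sets n y"
  then show "connected_component_set (generic_points n) x = connected_component_set (generic_points n) y"
    using same_signs_imp_connected_component[OF assms] by (simp add: connected_component_eq)
next
  assume *: "connected_component_set (generic_points n) x = connected_component_set (generic_points n) y"
  have xy: "x \<in> connected_component_set (generic_points n) x" "y \<in> connected_component_set (generic_points n) y"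
    using assms by (simp_all add: connected_component_refl_eq)
  then have "y \<in> connected_component_set (generic_points n) x" using * by simp
  with xy(1) show "positive_sets n x = positive_sets n y"
    by (intro subset_antisym
        connected_imp_positive_sets_subset[OF connected_connected_component connected_component_subset])
qed

text \<open>Maps with the same fibres have equally large images. Chambers and sign classes are both
  images of the generic points, which makes their numbers equal.\<close>

lemma card_image_cong_kernel:
  assumes "\<And>x y. \<lbrakk>x \<in> A; y \<in> A\<rbrakk> \<Longrightarrow> f x = f y \<longleftrightarrow> g x = g y"
  shows "card (f ` A) = card (g ` A)"
proof (rule bij_betw_same_card)
  have inv: "inv_into A f c \<in> A" "f (inv_into A f c) = c" if "c \<in> f ` A" for c
    using that by (simp_all add: inv_into_into f_inv_into_f)
  show "bij_betw (\<lambda>c. g (inv_into A f c)) (f ` A) (g ` A)"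
  proof (rule bij_betw_imageI)
    show "inj_on (\<lambda>c. g (inv_into A f c)) (f ` A)"
      by (rule inj_onI) (metis assms inv)
    show "(\<lambda>c. g (inv_into A f c)) ` f ` A = g ` A"
    proof -
      have "g (inv_into A f (f x)) = g x" if "x \<in> A" for x
        using assms[of "inv_into A f (f x)" x] inv[of "f x"] that by simp
      then show ?thesis by (simp add: image_image)
    qed
  qed
qed

lemma resonance_number_eq: "resonance_number n = card (positive_sets n ` generic_points n)"
  unfolding resonance_number_def resonance_chambers_def generic_points_eq[symmetric] components_def
  by (rule card_image_cong_kernel) (rule connected_component_generic_iff)

lemma sum_Compl_V_empty:
  assumes "x \<in> V_empty n" "S \<subseteq> {1..n + 1}"
  shows "sum x ({1..n + 1} - S) = - sum x S"
  using sum_diff[OF _ assms(2), of x] assms(1) unfolding V_empty_def by simp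

text \<open>Complementary index sets give opposite sums, so only those avoiding \<open>n + 1\<close>
  matter: the 2^n - 1 nonempty subsets of \<open>{1..n}\<close>. The space is spanned by n vectors,
  whence the exponent n - 1.\<close>

lemma resonance_number_le:
  assumes "n \<ge> 1"
  shows "resonance_number n \<le> 2 * (2 ^ n - 1) ^ (n - 1)"
proof -
  define I where "I = Pow {1..n} - {{}}"
  define B where "B = (\<lambda>i. basis_vec i - basis_vec (n + 1)) ` {1..n}"
  let ?h = "\<lambda>S x. sum x S :: real"
  have I_eq: "S \<in> I \<longleftrightarrow> S \<in> proper_subsets n \<and> n + 1 \<notin> S" for S
  proof
    assume "S \<in> I"
    then have S: "S \<noteq> {}" "S \<subseteq> {1..n}" by (auto simp: I_def)
    have "n + 1 \<in> {1..n + 1}" "n + 1 \<notin> {1..n}" "{1..n} \<subseteq> {1..n + 1}" by auto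
    with S show "S \<in> proper_subsets n \<and> n + 1 \<notin> S" unfolding proper_subsets_def by blast
  next
    assume S: "S \<in> proper_subsets n \<and> n + 1 \<notin> S"
    then have "S \<subseteq> {1..n + 1} - {n + 1}" "S \<noteq> {}" by (auto simp: proper_subsets_def simp del: add_Suc_right)
    moreover have "{1..n + 1} - {n + 1} = {1..n}" by auto
    ultimately show "S \<in> I" by (simp add: I_def)
  qed
  have "card (positive_sets n ` generic_points n) \<le> card (sign_patterns ?h I (V_empty n))"
  proof (rule card_inj_on_le[of "\<lambda>P. P \<inter> I"])
    show "finite (sign_patterns ?h I (V_empty n))"
      by (rule finite_sign_patterns) (simp add: I_def)
    show "(\<lambda>P. P \<inter> I) ` positive_sets n ` generic_points n \<subseteq> sign_patterns ?h I (V_empty n)"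
      unfolding image_image
    proof (intro image_subsetI)
      fix x assume "x \<in> generic_points n"
      then show "positive_sets n x \<inter> I \<in> sign_patterns ?h I (V_empty n)"
        by (intro sign_patternsI[of x]) (auto simp: generic_points_def positive_sets_def I_eq)
    qed
    have mem: "S \<in> positive_sets n x \<longleftrightarrow>
        (if n + 1 \<in> S then {1..n + 1} - S \<notin> positive_sets n x \<inter> I else S \<in> positive_sets n x \<inter> I)"
      if x: "x \<in> generic_points n" and S: "S \<in> proper_subsets n" for x S
    proof (cases "n + 1 \<in> S")
      case True
      have S': "{1..n + 1} - S \<in> proper_subsets n" using S unfolding proper_subsets_def by blast
      moreover have "S \<subseteq> {1..n + 1}" using S unfolding proper_subsets_def by blast
      then have "sum x ({1..n + 1} - S) = - sum x S"
        using x by (intro sum_Compl_V_empty) (simp_all add: generic_points_def)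
      moreover have "sum x S \<noteq> 0" using x S by (simp add: generic_points_def)
      moreover have "{1..n + 1} - S \<in> I" using S' True unfolding I_eq by blast
      ultimately show ?thesis using True S unfolding positive_sets_def by force
    next
      case False
      then show ?thesis using S I_eq by simp
    qed
    show "inj_on (\<lambda>P. P \<inter> I) (positive_sets n ` generic_points n)"
    proof (rule inj_onI, elim imageE)
      fix P Q x y
      assume PQ: "P \<inter> I = Q \<inter> I" "P = positive_sets n x" "Q = positive_sets n y"
        and xy: "x \<in> generic_points n" "y \<in> generic_points n"
      have "S \<in> P \<longleftrightarrow> S \<in> Q" if "S \<in> proper_subsets n" for S
        using mem[OF xy(1) that] mem[OF xy(2) that]
        unfolding PQ(2,3)[symmetric] PQ(1) by (simp only:)
      moreover have "P \<subseteq> proper_subsets n" "Q \<subseteq> proper_subsets n"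
        by (auto simp: PQ positive_sets_def)
      ultimately show "P = Q" by blast
    qed
  qed
  also have "\<dots> \<le> 2 * card I ^ (n - 1)"
    unfolding V_empty_eq_span B_def[symmetric]
  proof (rule card_sign_patterns_le)
    show "finite I" "finite B" by (simp_all add: I_def B_def)
    have "{1} \<in> I" using assms by (simp add: I_def)
    then show "I \<noteq> {}" by blast
    show "card B \<le> Suc (n - 1)"
      using card_image_le[of "{1..n}" "\<lambda>i. basis_vec i - basis_vec (n + 1)"] assms by (simp add: B_def)
  qed (rule linear_sum_eval)
  also have "card I = 2 ^ n - 1" by (simp add: I_def card_Diff_subset card_Pow)
  finally show ?thesis by (simp add: resonance_number_eq)
qed

section \<open>Cyclic shifts\<close>

text \<open>Addition of \<open>r\<close> modulo n + 1 with representatives 1 to n + 1, intended for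
  \<open>r \<le> n\<close>.\<close>

definition rot :: "nat \<Rightarrow> nat \<Rightarrow> nat \<Rightarrow> nat" where
  "rot n r i = (if i + r \<le> n + 1 then i + r else i + r - (n + 1))"

definition shift_coords :: "nat \<Rightarrow> nat \<Rightarrow> (nat \<Rightarrow> real) \<Rightarrow> nat \<Rightarrow> real" where
  "shift_coords n r x = (\<lambda>i. if i \<in> {1..n + 1} then x (rot n r i) else 0)"

text \<open>The cyclic shift transported from vectors to their sign classes.\<close>

definition shift_sets :: "nat \<Rightarrow> nat \<Rightarrow> nat set set \<Rightarrow> nat set set" where
  "shift_sets n r P = {S \<in> proper_subsets n. rot n r ` S \<in> P}"

lemma inj_on_rot: "r \<le> n \<Longrightarrow> inj_on (rot n r) {1..n + 1}"
  by (rule inj_onI) (auto simp: rot_def split: if_splits)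

lemma rot_image: "r \<le> n \<Longrightarrow> rot n r ` {1..n + 1} = {1..n + 1}"
  by (rule endo_inj_surj[OF _ _ inj_on_rot]) (auto simp: rot_def)

lemma rot_image_proper_iff:
  assumes "r \<le> n" "S \<subseteq> {1..n + 1}"
  shows "rot n r ` S \<in> proper_subsets n \<longleftrightarrow> S \<in> proper_subsets n"
proof -
  have "rot n r ` S = {1..n + 1} \<longleftrightarrow> S = {1..n + 1}"
    using inj_on_image_eq_iff[OF inj_on_rot[OF assms(1)] assms(2) order_refl] rot_image[OF assms(1)]
    by simp
  moreover have "rot n r ` S \<subseteq> {1..n + 1}" using rot_image[OF assms(1)] assms(2) by blast
  ultimately show ?thesis using assms(2) by (simp add: proper_subsets_def psubset_eq)
qed

lemma rot_preimage:
  assumes "r \<le> n" "T \<subseteq> {1..n + 1}"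
  obtains S where "S \<subseteq> {1..n + 1}" "rot n r ` S = T"
  using subset_imageE[of T "rot n r" "{1..n + 1}"] assms rot_image[OF assms(1)] by metis

lemma sum_shift_coords:
  assumes "r \<le> n" "S \<subseteq> {1..n + 1}"
  shows "sum (shift_coords n r x) S = sum x (rot n r ` S)"
proof -
  have "sum x (rot n r ` S) = sum (\<lambda>i. x (rot n r i)) S"
    using inj_on_subset[OF inj_on_rot[OF assms(1)] assms(2)] by (simp add: sum.reindex)
  also have "\<dots> = sum (shift_coords n r x) S"
    using assms(2) by (intro sum.cong) (auto simp: shift_coords_def)
  finally show ?thesis by simp
qed

lemma shift_coords_generic:
  assumes "r \<le> n" "x \<in> generic_points n"
  shows "shift_coords n r x \<in> generic_points n"
    and "positive_sets n (shift_coords n r x) = shift_sets n r (positive_sets n x)"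
proof -
  have sub: "S \<subseteq> {1..n + 1}" if "S \<in> proper_subsets n" for S
    using that unfolding proper_subsets_def by blast
  have "sum (shift_coords n r x) {1..n + 1} = 0"
    using sum_shift_coords[OF assms(1) order_refl, of x] rot_image[OF assms(1)] assms(2)
    by (simp add: generic_points_def V_empty_def)
  then have "shift_coords n r x \<in> V_empty n"
    unfolding V_empty_def by (simp add: shift_coords_def)
  moreover have sums: "sum (shift_coords n r x) S = sum x (rot n r ` S)"
    "rot n r ` S \<in> proper_subsets n" if "S \<in> proper_subsets n" for S
    using sum_shift_coords[OF assms(1) sub[OF that]] rot_image_proper_iff[OF assms(1) sub[OF that]] that
    by simp_all
  ultimately show "shift_coords n r x \<in> generic_points n"
    using assms(2) by (simp add: generic_points_def)
  show "positive_sets n (shift_coords n r x) = shift_sets n r (positive_sets n x)"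
    unfolding positive_sets_def shift_sets_def using sums by auto
qed

text \<open>The sign classes that can meet a root cone. The full prefix is left out because its sum
  is 0.\<close>

definition prefix_positive :: "nat \<Rightarrow> nat set set set" where
  "prefix_positive n =
     {P \<in> positive_sets n ` generic_points n. \<forall>k\<in>{1..n}. {1..k} \<in> P}"

lemma prefix_positive_suffix:
  assumes "P \<in> prefix_positive n" "k \<in> {1..n}"
  shows "{k + 1..n + 1} \<notin> P"
proof
  assume suffix: "{k + 1..n + 1} \<in> P"
  obtain x where x: "x \<in> generic_points n" "P = positive_sets n x"
    using assms(1) by (auto simp: prefix_positive_def)
  have "{1..k} \<in> P" using assms by (simp add: prefix_positive_def)
  then have "0 < sum x {1..k} + sum x {k + 1..n + 1}"
    using suffix x(2) by (simp add: positive_sets_def)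
  also have "\<dots> = sum x ({1..k} \<union> {k + 1..n + 1})"
    by (rule sum.union_disjoint[symmetric]) auto
  also have "{1..k} \<union> {k + 1..n + 1} = {1..n + 1}" using assms(2) by auto
  also have "sum x {1..n + 1} = 0" using x(1) by (simp add: generic_points_def V_empty_def)
  finally show False by simp
qed

text \<open>Some \<open>S\<close> is rotated by \<open>r\<close> onto a suffix and by
  \<open>s\<close> onto a prefix. Equality of the two shifted classes would carry the positive
  prefix of \<open>Q\<close> to a positive suffix of \<open>P\<close>, against total sum 0.\<close>

lemma shift_sets_prefix_positive_neq:
  assumes P: "P \<in> prefix_positive n" and Q: "Q \<in> prefix_positive n" and rs: "r < s" "s \<le> n"
  shows "shift_sets n r P \<noteq> shift_sets n s Q"
proof
  assume eq: "shift_sets n r P = shift_sets n s Q"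
  define t where "t = s - r"
  \<comment> \<open>The suffix after \<open>k\<close> consists of the last \<open>t\<close>
    positions, exactly those that a further rotation by \<open>t\<close> wraps around to the
    front.\<close>
  define k where "k = n + 1 - t"
  have k: "k \<in> {1..n}" "t \<in> {1..n}" "r \<le> n" using rs by (auto simp: t_def k_def)
  obtain S where S: "S \<subseteq> {1..n + 1}" "rot n r ` S = {k + 1..n + 1}"
    using rot_preimage[of r n "{k + 1..n + 1}"] k by auto
  have "rot n s i = rot n r i - k" if "i \<in> S" for i
  proof -
    have "rot n r i \<in> {k + 1..n + 1}" using S(2) that by blast
    moreover have "i \<in> {1..n + 1}" using S(1) that by blast
    ultimately show ?thesis using rs by (auto simp: rot_def t_def k_def split: if_splits)
  qed
  then have "rot n s ` S = (\<lambda>i. i - k) ` rot n r ` S" by (force simp: image_image)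
  also have "\<dots> = {1..t}"
  proof -
    have "i \<in> (\<lambda>i. i - k) ` {k + 1..n + 1}" if "i \<in> {1..t}" for i
      using that k by (intro image_eqI[of _ _ "i + k"]) (auto simp: k_def)
    then show ?thesis unfolding S(2) using k by (auto simp: k_def)
  qed
  finally have "rot n s ` S = {1..t}" .
  moreover have "{1..t} \<in> Q" using Q k(2) by (simp add: prefix_positive_def)
  moreover have "Q \<subseteq> proper_subsets n" using Q by (auto simp: prefix_positive_def positive_sets_def)
  ultimately have "S \<in> shift_sets n s Q"
    using rot_image_proper_iff[OF rs(2) S(1)] by (auto simp: shift_sets_def)
  then have "{k + 1..n + 1} \<in> P" unfolding eq[symmetric] by (simp add: shift_sets_def S(2))
  then show False using prefix_positive_suffix[OF P k(1)] by simp
qed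

lemma shift_sets_inj:
  assumes "r \<le> n" "P \<subseteq> proper_subsets n" "Q \<subseteq> proper_subsets n" "shift_sets n r P = shift_sets n r Q"
  shows "P = Q"
proof -
  have "P \<subseteq> Q" if PQ: "P \<subseteq> proper_subsets n" "shift_sets n r P = shift_sets n r Q" for P Q
  proof
    fix T assume T: "T \<in> P"
    then have T': "T \<in> proper_subsets n" using PQ(1) by blast
    then have "T \<subseteq> {1..n + 1}" unfolding proper_subsets_def by blast
    then obtain S where S: "S \<subseteq> {1..n + 1}" "rot n r ` S = T"
      using rot_preimage[OF assms(1)] by blast
    then have "S \<in> shift_sets n r P"
      using T T' rot_image_proper_iff[OF assms(1) S(1)] by (simp add: shift_sets_def)
    then show "T \<in> Q" unfolding PQ(2) by (simp add: shift_sets_def S(2))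
  qed
  from this[OF assms(2,4)] this[OF assms(3) assms(4)[symmetric]] show ?thesis by (rule subset_antisym)
qed

text \<open>The n + 1 shifts \<open>r \<in> {..n}\<close> of prefix-positive classes are pairwise
  distinct: different \<open>r\<close> by the suffix argument, equal \<open>r\<close> because a
  rotation is invertible.\<close>

lemma card_prefix_positive_le:
  "(n + 1) * card (prefix_positive n) \<le> card (positive_sets n ` generic_points n)"
proof -
  have "card ({..n} \<times> prefix_positive n) \<le> card (positive_sets n ` generic_points n)"
  proof (rule card_inj_on_le[of "\<lambda>(r, P). shift_sets n r P"])
    show "inj_on (\<lambda>(r, P). shift_sets n r P) ({..n} \<times> prefix_positive n)"
    proof (rule inj_onI)
      fix p q
      assume pq: "p \<in> {..n} \<times> prefix_positive n" "q \<in> {..n} \<times> prefix_positive n"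
        "(\<lambda>(r, P). shift_sets n r P) p = (\<lambda>(r, P). shift_sets n r P) q"
      obtain r P s Q where p: "p = (r, P)" and q: "q = (s, Q)" by (metis prod.exhaust)
      have *: "r \<in> {..n}" "s \<in> {..n}" "P \<in> prefix_positive n" "Q \<in> prefix_positive n"
        "shift_sets n r P = shift_sets n s Q"
        using pq unfolding p q by simp_all
      have "r = s"
        using shift_sets_prefix_positive_neq[OF *(3,4), of r s]
          shift_sets_prefix_positive_neq[OF *(4,3), of s r] * by (cases r s rule: linorder_cases) auto
      have "P \<subseteq> proper_subsets n" "Q \<subseteq> proper_subsets n"
        using *(3,4) by (auto simp: prefix_positive_def positive_sets_def)
      then have "P = Q" using shift_sets_inj[of r n P Q] * \<open>r = s\<close> by simp
      with \<open>r = s\<close> show "p = q" by (simp add: p q)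
    qed
    show "(\<lambda>(r, P). shift_sets n r P) ` ({..n} \<times> prefix_positive n)
        \<subseteq> positive_sets n ` generic_points n"
    proof (rule image_subsetI)
      fix p assume p: "p \<in> {..n} \<times> prefix_positive n"
      obtain r P where rP: "p = (r, P)" by (metis prod.exhaust)
      have *: "r \<in> {..n}" "P \<in> prefix_positive n" using p unfolding rP by simp_all
      then obtain x where x: "x \<in> generic_points n" "P = positive_sets n x"
        by (auto simp: prefix_positive_def)
      then show "(case p of (r, P) \<Rightarrow> shift_sets n r P) \<in> positive_sets n ` generic_points n"
        unfolding rP using shift_coords_generic[of r n x] *
        by (intro image_eqI[of _ _ "shift_coords n r x"]) simp_all
    qed
  qed (rule finite_positive_sets_image)
  then show ?thesis by (simp add: card_cartesian_product)
qed

section \<open>Kostant chambers\<close>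

text \<open>An intersection of root cones is again a cone, and being full-dimensional it contains a
  generic point. The family \<open>\<D>\<close> is kept along with the point because
  \<open>M\<close> records only its interior.\<close>

lemma kostant_chamberE:
  assumes "M \<in> kostant_chambers n"
  obtains \<D> x where "\<D> \<noteq> {}" "\<D> \<subseteq> {root_cone E |E. positive_alternating_tree n E}"
    "M = top_of_set (V_empty n) interior_of \<Inter>\<D>" "x \<in> \<Inter>\<D>" "x \<in> generic_points n"
proof -
  obtain \<D> where \<D>: "\<D> \<noteq> {}" "\<D> \<subseteq> {root_cone E |E. positive_alternating_tree n E}"
    "M = top_of_set (V_empty n) interior_of \<Inter>\<D>" "dim (\<Inter>\<D>) = dim (V_empty n)"
    using assms unfolding kostant_chambers_def maximally_refined_chambers_def refined_chambers_def
    by blast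
  have "\<exists>x\<in>\<Inter>\<D>. x \<in> generic_points n"
  proof (rule full_dim_cone_has_generic_point)
    show "\<Inter>\<D> \<subseteq> V_empty n"
    proof -
      obtain E where "root_cone E \<in> \<D>" "positive_alternating_tree n E" using \<D>(1,2) by blast
      then show ?thesis
        using root_cone_subset_V_empty[of E n] unfolding positive_alternating_tree_def by blast
    qed
    have "0 \<in> \<Inter>\<D>" using \<D>(2) zero_in_root_cone by blast
    then show "\<Inter>\<D> \<noteq> {}" by blast
    show "x + y \<in> \<Inter>\<D>" if "x \<in> \<Inter>\<D>" "y \<in> \<Inter>\<D>" for x y
      using that \<D>(2) root_cone_add by blast
    show "t *\<^sub>R x \<in> \<Inter>\<D>" if "x \<in> \<Inter>\<D>" "0 \<le> t" for x t
      using that \<D>(2) root_cone_scale by blast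
  qed (rule \<D>(4))
  then show ?thesis using that \<D> by blast
qed

lemma kostant_chamber_maximal:
  assumes "M \<in> kostant_chambers n" "\<D> \<noteq> {}" "\<D> \<subseteq> {root_cone E |E. positive_alternating_tree n E}"
    and "dim (\<Inter>\<D>) = dim (V_empty n)" "top_of_set (V_empty n) interior_of \<Inter>\<D> \<subseteq> M"
  shows "top_of_set (V_empty n) interior_of \<Inter>\<D> = M"
proof -
  have "top_of_set (V_empty n) interior_of \<Inter>\<D>
      \<in> refined_chambers (V_empty n) {root_cone E |E. positive_alternating_tree n E}"
    unfolding refined_chambers_def using assms(2-4) by blast
  then show ?thesis
    using assms(1,5) unfolding kostant_chambers_def maximally_refined_chambers_def by blast
qed

text \<open>
  Two Kostant chambers whose cones share a sign class have a full-dimensional common refinement, so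
  they agree by maximality.
\<close>

lemma kostant_chambers_eq_if_same_signs:
  assumes M: "M \<in> kostant_chambers n" "\<D> \<noteq> {}" "\<D> \<subseteq> {root_cone E |E. positive_alternating_tree n E}"
    "M = top_of_set (V_empty n) interior_of \<Inter>\<D>" "x \<in> \<Inter>\<D>" "x \<in> generic_points n"
    and N: "N \<in> kostant_chambers n" "\<E> \<subseteq> {root_cone E |E. positive_alternating_tree n E}"
    "N = top_of_set (V_empty n) interior_of \<Inter>\<E>" "y \<in> \<Inter>\<E>" "y \<in> generic_points n"
    and eq: "positive_sets n x = positive_sets n y"
  shows "M = N"
proof -
  let ?\<F> = "\<D> \<union> \<E>"
  have F: "?\<F> \<noteq> {}" "?\<F> \<subseteq> {root_cone E |E. positive_alternating_tree n E}"
    using M(2,3) N(2) by blast+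
  have "dim (\<Inter>?\<F>) = dim (V_empty n)"
  proof (rule full_dim_if_contains_sign_class[OF M(6)])
    obtain E where "root_cone E \<in> \<D>" "positive_alternating_tree n E" using M(2,3) by blast
    then show "\<Inter>?\<F> \<subseteq> V_empty n"
      using root_cone_subset_V_empty[of E n] unfolding positive_alternating_tree_def by blast
    fix z assume z: "z \<in> generic_points n" "positive_sets n z = positive_sets n x"
    show "z \<in> \<Inter>?\<F>"
    proof
      fix K assume K: "K \<in> ?\<F>"
      then obtain E where E: "K = root_cone E" "positive_alternating_tree n E" using F(2) by blast
      \<comment> \<open>All three points share a sign class, so \<open>z\<close> inherits membership
        in \<open>K\<close> from whichever of \<open>x\<close> and \<open>y\<close> has it.\<close>
      have "x \<in> K \<or> y \<in> K" using K M(5) N(4) by blast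
      then show "z \<in> K"
        using root_cone_sign_determined[OF E(2) _ M(6) z]
          root_cone_sign_determined[OF E(2) _ N(5) z(1) z(2)[unfolded eq]] E(1) by blast
    qed
  qed
  moreover have "top_of_set (V_empty n) interior_of \<Inter>?\<F> \<subseteq> M"
    unfolding M(4) by (rule interior_of_mono) blast
  moreover have "top_of_set (V_empty n) interior_of \<Inter>?\<F> \<subseteq> N"
    unfolding N(3) by (rule interior_of_mono) blast
  ultimately show ?thesis
    using kostant_chamber_maximal[OF M(1) F] kostant_chamber_maximal[OF N(1) F] by simp
qed

text \<open>Genericity turns the nonnegative prefix sums of a root cone into positive ones.\<close>

lemma root_cone_generic_prefix_positive:
  assumes "positive_alternating_tree n E" "x \<in> root_cone E" "x \<in> generic_points n"
  shows "positive_sets n x \<in> prefix_positive n"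
proof -
  have "{1..k} \<in> positive_sets n x" if k: "k \<in> {1..n}" for k
  proof -
    have "n + 1 \<in> {1..n + 1}" "n + 1 \<notin> {1..k}" "{1..k} \<subseteq> {1..n + 1}" "{1..k} \<noteq> {}"
      using k by auto
    then have "{1..k} \<in> proper_subsets n" unfolding proper_subsets_def by blast
    moreover from this have "sum x {1..k} \<noteq> 0" using assms(3) by (simp add: generic_points_def)
    ultimately show ?thesis
      using root_cone_prefix_sum_nonneg[OF assms(1,2), of k] by (simp add: positive_sets_def)
  qed
  then show ?thesis using assms(3) by (simp add: prefix_positive_def)
qed

text \<open>A generic point is chosen for each Kostant chamber. Its sign class determines the
  chamber, which gives an injection into a finite set.\<close>

lemma kostant_number_le: "kostant_number n \<le> card (prefix_positive n)"
proof -
  define good where "good M x \<longleftrightarrow> x \<in> generic_points n \<and>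
    (\<exists>\<D>. \<D> \<noteq> {} \<and> \<D> \<subseteq> {root_cone E |E. positive_alternating_tree n E} \<and>
      M = top_of_set (V_empty n) interior_of \<Inter>\<D> \<and> x \<in> \<Inter>\<D>)" for M and x :: "nat \<Rightarrow> real"
  have "\<exists>x. good M x" if M: "M \<in> kostant_chambers n" for M
  proof -
    obtain \<D> x where "\<D> \<noteq> {}" "\<D> \<subseteq> {root_cone E |E. positive_alternating_tree n E}"
      "M = top_of_set (V_empty n) interior_of \<Inter>\<D>" "x \<in> \<Inter>\<D>" "x \<in> generic_points n"
      using M by (rule kostant_chamberE)
    then have "good M x" unfolding good_def by (intro conjI exI[of _ \<D>])
    then show "\<exists>x. good M x" by blast
  qed
  then obtain pt where pt: "\<And>M. M \<in> kostant_chambers n \<Longrightarrow> good M (pt M)" by metis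
  show ?thesis
    unfolding kostant_number_def
  proof (rule card_inj_on_le[of "\<lambda>M. positive_sets n (pt M)"])
    show "inj_on (\<lambda>M. positive_sets n (pt M)) (kostant_chambers n)"
    proof (rule inj_onI)
      fix M N
      assume MN: "M \<in> kostant_chambers n" "N \<in> kostant_chambers n"
        and eq: "positive_sets n (pt M) = positive_sets n (pt N)"
      obtain \<D> where D: "\<D> \<noteq> {}" "\<D> \<subseteq> {root_cone E |E. positive_alternating_tree n E}"
        "M = top_of_set (V_empty n) interior_of \<Inter>\<D>" "pt M \<in> \<Inter>\<D>" "pt M \<in> generic_points n"
        using pt[OF MN(1)] unfolding good_def by blast
      obtain \<E> where E: "\<E> \<subseteq> {root_cone E |E. positive_alternating_tree n E}"
        "N = top_of_set (V_empty n) interior_of \<Inter>\<E>" "pt N \<in> \<Inter>\<E>" "pt N \<in> generic_points n"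
        using pt[OF MN(2)] unfolding good_def by blast
      show "M = N" by (rule kostant_chambers_eq_if_same_signs[OF MN(1) D MN(2) E eq])
    qed
    show "(\<lambda>M. positive_sets n (pt M)) ` kostant_chambers n \<subseteq> prefix_positive n"
    proof (rule image_subsetI)
      fix M assume "M \<in> kostant_chambers n"
      then have "good M (pt M)" by (rule pt)
      then obtain E where "positive_alternating_tree n E" "pt M \<in> root_cone E" "pt M \<in> generic_points n"
        unfolding good_def by blast
      then show "positive_sets n (pt M) \<in> prefix_positive n" by (rule root_cone_generic_prefix_positive)
    qed
    show "finite (prefix_positive n)"
      unfolding prefix_positive_def using finite_positive_sets_image by simp
  qed
qed

section \<open>From the counting inequalities to the quotient and logarithmic bounds\<close>

theorem mainTheorem2:
  fixes n :: nat
  assumes "n \<ge> 2"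
  shows "real (kostant_number n) \<le> real (resonance_number n) / real (n + 1) \<and>
         log 2 (real (kostant_number n)) \<le> (real n)\<^sup>2 - 1 - log 2 (real (n + 1))"
proof
  have "(n + 1) * kostant_number n \<le> (n + 1) * card (prefix_positive n)"
    using kostant_number_le by (rule mult_le_mono2)
  also have "\<dots> \<le> resonance_number n"
    unfolding resonance_number_eq by (rule card_prefix_positive_le)
  finally have KR: "(n + 1) * kostant_number n \<le> resonance_number n" .
  then have "real (n + 1) * real (kostant_number n) \<le> real (resonance_number n)"
    by (simp only: flip: of_nat_mult)
  then show "real (kostant_number n) \<le> real (resonance_number n) / real (n + 1)"
    by (simp add: pos_le_divide_eq mult.commute)
  have "n\<^sup>2 \<ge> 2 * n" using assms by (simp add: power2_eq_square)
  note KR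
  also have "resonance_number n \<le> 2 * (2 ^ n - 1) ^ (n - 1)"
    using assms by (intro resonance_number_le) simp
  also have "\<dots> \<le> 2 * (2 ^ n) ^ (n - 1)"
    by (intro mult_le_mono2 power_mono) simp_all
  also have "\<dots> = 2 ^ (n * (n - 1) + 1)" by (simp add: power_mult)
  also have "\<dots> \<le> 2 ^ (n\<^sup>2 - 1)"
  proof (rule power_increasing)
    \<comment> \<open>The exponent is n^2 - n + 1, and n \<ge> 2 is what brings it down to n^2 -
      1.\<close>
    have "n * (n - 1) + n = n\<^sup>2" using assms by (cases n) (simp_all add: power2_eq_square)
    then show "n * (n - 1) + 1 \<le> n\<^sup>2 - 1" using assms by linarith
  qed simp
  finally have K: "(n + 1) * kostant_number n \<le> 2 ^ (n\<^sup>2 - 1)" .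
  have exponent: "real (n\<^sup>2 - 1) = (real n)\<^sup>2 - 1" using assms by (simp add: of_nat_diff)
  show "log 2 (real (kostant_number n)) \<le> (real n)\<^sup>2 - 1 - log 2 (real (n + 1))"
  proof (cases "kostant_number n = 0")
    \<comment> \<open>here \<open>log 2 0 = 0\<close>\<close>
    case True
    \<comment> \<open>It remains to bound \<open>log 2 (n + 1)\<close> by n^2 - 1, through n + 1
      \<le> 2^n and n \<le> n^2 - 1.\<close>
    have "n < 2 ^ n" by (rule less_exp)
    then have "n + 1 \<le> 2 ^ n" by linarith
    also have "(2::nat) ^ n \<le> 2 ^ (n\<^sup>2 - 1)"
      using \<open>n\<^sup>2 \<ge> 2 * n\<close> assms by (intro power_increasing) simp_all
    finally have "real (n + 1) \<le> real (2 ^ (n\<^sup>2 - 1))" by (simp only: of_nat_le_iff)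
    then have "log 2 (real (n + 1)) \<le> log 2 (real (2 ^ (n\<^sup>2 - 1)))"
      by (intro log_mono) simp_all
    also have "\<dots> = (real n)\<^sup>2 - 1" by (simp flip: exponent)
    finally show ?thesis using True by (simp add: log_def)
  next
    case False
    then have pos: "0 < real ((n + 1) * kostant_number n)" by (simp only: of_nat_0_less_iff) simp
    have le: "real ((n + 1) * kostant_number n) \<le> real (2 ^ (n\<^sup>2 - 1))"
      using K by (simp only: of_nat_le_iff)
    have "log 2 (real (n + 1)) + log 2 (real (kostant_number n))
        = log 2 (real ((n + 1) * kostant_number n))"
      using False by (subst of_nat_mult) (simp add: log_mult)
    also have "\<dots> \<le> log 2 (real (2 ^ (n\<^sup>2 - 1)))"
      using pos le by (intro log_mono) simp_all
    also have "\<dots> = (real n)\<^sup>2 - 1" by (simp flip: exponent)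
    finally show ?thesis by simp
  qed
qed

end
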